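(* Let $n\in\mathbb N$, $s\in(0,1)$ and let $A$ be a Young function. (i) One has $V^{s,A}(\mathbb R^n)\to \mathrm{BMO}(\mathbb R^n)$ if and only if there is a positive constant $c$ such that $$\frac{A(t)}{t^{n/s}}\ge c\qquad\text{for all } t>0 .$$ (ii) One has $V^{s,A}(\mathbb R^n)\to \mathrm{VMO}(\mathbb R^n)$ uniformly if and only if there is a positive constant $c$ such that $A(t)/t^{n/s}\ge c$ for all $t>0$, and $$\lim_{t\to\infty}\frac{A(t)}{t^{n/s}}=\infty .$$
   Context: A Young function is a convex, left-continuous function $A:[0,\infty)\to[0,\infty]$, non-constant in $(0,\infty)$, with $A(0)=0$. For $s\in(0,1)$ and a measurable $u:\mathbb R^n\to\mathbb R$, set $$J_{s,A}(u)=\int_{\mathbb R^n}\int_{\mathbb R^n}A\left(\frac{|u(x)-u(y)|}{|x-y|^s}\right)\frac{dx\,dy}{|x-y|^n},\qquad |u|_{s,A,\mathbb R^n}=\inf\{\lambda>0:\ J_{s,A}(u/\lambda)\le1\},$$ and $V^{s,A}(\mathbb R^n)=\{u\text{ measurable on }\mathbb R^n:\ |u|_{s,A,\mathbb R^n}<\infty\}$. $\mathrm{BMO}(\mathbb R^n)$ is the space of $u\in L^1_{\rm loc}(\mathbb R^n)$ with finite seminorm $\sup_B\frac1{|B|}\int_B|u-u_B|\,dx$, where the supremum is over all balls $B\subset\mathbb R^n$ and $u_B=\frac1{|B|}\int_Bu\,dx$. $\mathrm{VMO}(\mathbb R^n)$ is the set of $u\in\mathrm{BMO}(\mathbb R^n)$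 with $\lim_{r\to0^+}\sup_{|B|\le r}\frac1{|B|}\int_B|u-u_B|\,dx=0$. The arrow $\to$ denotes a continuous embedding, i.e. inclusion together with a bound of the target seminorm by a constant times $|u|_{s,A,\mathbb R^n}$. One says that $V^{s,A}(\mathbb R^n)\to\mathrm{VMO}(\mathbb R^n)$ uniformly if $V^{s,A}(\mathbb R^n)\to\mathrm{BMO}(\mathbb R^n)$ and $$\lim_{r\to0^+}\ \sup_{|u|_{s,A,\mathbb R^n}\le1}\ \sup_{|B|\le r}\frac1{|B|}\int_B|u-u_B|\,dx=0,$$ where $B$ ranges over balls in $\mathbb R^n$. *)

theory Defs
  imports "HOL-Analysis.Analysis"
begin

text \<open>
  A Young function is represented by a total function \<^typ>\<open>real \<Rightarrow> ennreal\<close>; only its values on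
  \<open>[0,\<infinity>)\<close> are constrained, and only those are used below. Convexity is written out because
  the library predicate is for real-valued functions (here \<open>0 * \<infinity> = 0\<close>).
\<close>

definition young_function :: "(real \<Rightarrow> ennreal) \<Rightarrow> bool" where
  "young_function A \<longleftrightarrow>
     A 0 = 0 \<and>
     (\<forall>x\<ge>0. \<forall>y\<ge>0. \<forall>\<theta>\<in>{0..1}.
        A (\<theta> * x + (1 - \<theta>) * y) \<le> ennreal \<theta> * A x + ennreal (1 - \<theta>) * A y) \<and>
     (\<forall>t>0. continuous (at_left t) A) \<and>
     \<not> A constant_on {0<..}"

text \<open>
  The diagonal \<open>x = y\<close>, where the integrand is \<open>A 0 / 0 = 0\<close> by convention, is a null set.
\<close>

definition J_fun :: "real \<Rightarrow> (real \<Rightarrow> ennreal) \<Rightarrow> (real ^ 'n::finite \<Rightarrow> real) \<Rightarrow> ennreal" where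
  "J_fun s A u =
     (\<integral>\<^sup>+ y. (\<integral>\<^sup>+ x. A (\<bar>u x - u y\<bar> / norm (x - y) powr s) / ennreal (norm (x - y) ^ CARD('n))
        \<partial>lebesgue) \<partial>lebesgue)"

text \<open>The infimum is taken in \<open>[0,\<infinity>]\<close>, so it is \<open>\<infinity>\<close> for the empty set.\<close>

definition V_seminorm :: "real \<Rightarrow> (real \<Rightarrow> ennreal) \<Rightarrow> (real ^ 'n::finite \<Rightarrow> real) \<Rightarrow> ennreal" where
  "V_seminorm s A u = (INF k\<in>{k. k > 0 \<and> J_fun s A (\<lambda>x. u x / k) \<le> 1}. ennreal k)"

definition V_space :: "real \<Rightarrow> (real \<Rightarrow> ennreal) \<Rightarrow> (real ^ 'n::finite \<Rightarrow> real) set" where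
  "V_space s A = {u. u \<in> borel_measurable lebesgue \<and> V_seminorm s A u < \<infinity>}"

definition L1_loc :: "(real ^ 'n::finite \<Rightarrow> real) set" where
  "L1_loc = {u. \<forall>K. compact K \<longrightarrow> set_integrable lebesgue K u}"

definition balls :: "(real ^ 'n::finite) set set" where
  "balls = {ball x \<rho> | x \<rho>. \<rho> > 0}"

definition average :: "(real ^ 'n::finite) set \<Rightarrow> (real ^ 'n \<Rightarrow> real) \<Rightarrow> real" where
  "average B u = (LINT x:B|lebesgue. u x) / measure lebesgue B"

text \<open>
  For \<open>u\<close> in \<open>L1_loc\<close> the value is finite. Outside \<open>L1_loc\<close> the average may be the
  default value of a divergent integral; every use below is accompanied by membership in \<open>L1_loc\<close>.
\<close>

definition mean_osc :: "(real ^ 'n::finite) set \<Rightarrow> (real ^ 'n \<Rightarrow> real) \<Rightarrow> ennreal" where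
  "mean_osc B u = (\<integral>\<^sup>+ x\<in>B. ennreal \<bar>u x - average B u\<bar> \<partial>lebesgue) / emeasure lebesgue B"

definition BMO_seminorm :: "(real ^ 'n::finite \<Rightarrow> real) \<Rightarrow> ennreal" where
  "BMO_seminorm u = (SUP B\<in>balls. mean_osc B u)"

definition BMO :: "(real ^ 'n::finite \<Rightarrow> real) set" where
  "BMO = {u \<in> L1_loc. BMO_seminorm u < \<infinity>}"

text \<open>The parameter \<open>r\<close> bounds the measure of the ball, not its radius.\<close>

definition small_osc :: "real \<Rightarrow> (real ^ 'n::finite \<Rightarrow> real) \<Rightarrow> ennreal" where
  "small_osc r u = (SUP B\<in>{B \<in> balls. emeasure lebesgue B \<le> ennreal r}. mean_osc B u)"

definition VMO :: "(real ^ 'n::finite \<Rightarrow> real) set" where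
  "VMO = {u \<in> BMO. ((\<lambda>r. small_osc r u) \<longlongrightarrow> 0) (at_right 0)}"

definition continuous_embedding ::
  "'a set \<Rightarrow> ('a \<Rightarrow> ennreal) \<Rightarrow> 'a set \<Rightarrow> ('a \<Rightarrow> ennreal) \<Rightarrow> bool" where
  "continuous_embedding V p W q \<longleftrightarrow>
     V \<subseteq> W \<and> (\<exists>C::real. C > 0 \<and> (\<forall>u\<in>V. q u \<le> ennreal C * p u))"

definition uniform_VMO_embedding ::
  "(real ^ 'n::finite \<Rightarrow> real) set \<Rightarrow> ((real ^ 'n \<Rightarrow> real) \<Rightarrow> ennreal) \<Rightarrow> bool" where
  "uniform_VMO_embedding V p \<longleftrightarrow>
     continuous_embedding V p BMO BMO_seminorm \<and>
     ((\<lambda>r. SUP u\<in>{u \<in> V. p u \<le> 1}. small_osc r u) \<longlongrightarrow> 0) (at_right 0)"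

text \<open>
  \<^const>\<open>VMO\<close> does not occur in the definition of the uniform embedding; the inclusion is a
  consequence of it.
\<close>

lemma mean_osc_cmult:
  assumes "u \<in> borel_measurable lebesgue" "c > 0" "B \<in> sets lebesgue"
  shows "mean_osc B (\<lambda>x. c * u x) = ennreal c * mean_osc B u"
proof -
  have avg: "average B (\<lambda>x. c * u x) = c * average B u"
    by (simp add: average_def)
  have *: "ennreal \<bar>c * u x - c * average B u\<bar> * indicator B x
      = ennreal c * (ennreal \<bar>u x - average B u\<bar> * indicator B x)" for x
  proof -
    have "\<bar>c * u x - c * average B u\<bar> = c * \<bar>u x - average B u\<bar>"
      using \<open>c > 0\<close> by (simp add: abs_mult flip: right_diff_distrib)
    then show ?thesis using \<open>c > 0\<close> by (simp add: ennreal_mult mult.assoc)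
  qed
  have [measurable]: "u \<in> borel_measurable lebesgue" "B \<in> sets lebesgue"
    using assms by auto
  have "(\<integral>\<^sup>+ x\<in>B. ennreal \<bar>c * u x - c * average B u\<bar> \<partial>lebesgue)
      = ennreal c * (\<integral>\<^sup>+ x\<in>B. ennreal \<bar>u x - average B u\<bar> \<partial>lebesgue)"
    unfolding * by (rule nn_integral_cmult) measurable
  then show ?thesis
    by (simp add: mean_osc_def avg ennreal_times_divide)
qed

lemma uniform_VMO_embedding_imp_subset_VMO:
  assumes "uniform_VMO_embedding (V_space s A :: (real ^ 'n::finite \<Rightarrow> real) set) (V_seminorm s A)"
  shows "(V_space s A :: (real ^ 'n \<Rightarrow> real) set) \<subseteq> VMO"
proof
  fix u :: "real ^ 'n \<Rightarrow> real" assume u: "u \<in> V_space s A"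
  then have um: "u \<in> borel_measurable lebesgue" and "V_seminorm s A u < \<infinity>"
    by (auto simp: V_space_def)
  then obtain l where l: "l > 0" "J_fun s A (\<lambda>x. u x / l) \<le> 1"
    by (auto simp: V_seminorm_def INF_less_iff)
  define v where "v = (\<lambda>x. u x / l)"
  have vm: "v \<in> borel_measurable lebesgue" using um by (simp add: v_def)
  have v1: "V_seminorm s A v \<le> 1"
    unfolding V_seminorm_def by (rule INF_lower2[of 1]) (use l in \<open>auto simp: v_def\<close>)
  have v: "v \<in> {u \<in> V_space s A. V_seminorm s A u \<le> 1}"
    using v1 vm by (auto simp: V_space_def intro: le_less_trans)
  have uv: "u = (\<lambda>x. l * v x)" using l by (auto simp: v_def)
  define U where "U = {w \<in> V_space s A :: (real ^ 'n \<Rightarrow> real) set. V_seminorm s A w \<le> 1}"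
  have le: "small_osc r u \<le> ennreal l * (SUP w\<in>U. small_osc r w)" for r
    unfolding small_osc_def[of r u]
  proof (rule SUP_least)
    fix B :: "(real ^ 'n) set" assume B: "B \<in> {B \<in> balls. emeasure lebesgue B \<le> ennreal r}"
    then have "B \<in> sets lebesgue" by (auto simp: balls_def)
    then have "mean_osc B u = ennreal l * mean_osc B v"
      using mean_osc_cmult[OF vm l(1)] by (simp only: uv)
    moreover have "mean_osc B v \<le> small_osc r v"
      unfolding small_osc_def using B by (rule SUP_upper)
    moreover have "small_osc r v \<le> (SUP w\<in>U. small_osc r w)"
      using v unfolding U_def by (rule SUP_upper)
    ultimately show "mean_osc B u \<le> ennreal l * (SUP w\<in>U. small_osc r w)"
      using mult_left_mono[of "mean_osc B v" "SUP w\<in>U. small_osc r w" "ennreal l"] by simp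
  qed
  have lim: "((\<lambda>r. ennreal l * (SUP w\<in>U. small_osc r w)) \<longlongrightarrow> ennreal l * 0) (at_right 0)"
    using assms unfolding U_def
    by (intro ennreal_tendsto_cmult) (auto simp: uniform_VMO_embedding_def)
  have "((\<lambda>r. small_osc r u) \<longlongrightarrow> 0) (at_right 0)"
  proof (rule tendsto_sandwich[OF _ _ tendsto_const lim[unfolded mult_zero_right]])
    show "\<forall>\<^sub>F r in at_right 0. 0 \<le> small_osc r u"
      by (rule always_eventually) simp
    show "\<forall>\<^sub>F r in at_right 0. small_osc r u \<le> ennreal l * (SUP w\<in>U. small_osc r w)"
      by (rule always_eventually) (rule allI, rule le)
  qed
  moreover have "u \<in> BMO"
    using assms u unfolding uniform_VMO_embedding_def continuous_embedding_def by (blast dest: subsetD)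
  ultimately show "u \<in> VMO"
    unfolding VMO_def by blast
qed

end

theory Submission
  imports Defs
begin

text \<open>
  Put \<open>p = n / s\<close>. If \<open>A t \<ge> M t\<^sup>p\<close> for \<open>t \<ge> T\<close>, then for \<open>x\<close>, \<open>y\<close> in a ball of radius \<open>r\<close> either
  \<open>|u x - u y| \<le> T (2r)\<^sup>s\<close> or the integrand of the modular dominates \<open>M |u x - u y|\<^sup>p / (2r)\<^sup>2\<^sup>n\<close>. Since
  \<open>a \<le> e + e\<^sup>1\<^sup>-\<^sup>p a\<^sup>p\<close>, integrating over the square of the ball bounds the mean oscillation by
  \<open>T (2r)\<^sup>s + e + C e\<^sup>1\<^sup>-\<^sup>p / M\<close>. The choice \<open>T = 0\<close>, \<open>e = 1\<close> gives BMO; large \<open>M\<close>, then small \<open>r\<close>, gives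
  the uniform VMO bound.

  Conversely, the tent \<open>t r\<^sup>s\<^sup>-\<^sup>1 (r - |x|)\<^sub>+\<close> has difference quotients of order \<open>s\<close> at most \<open>t\<close>, so only
  \<open>A t\<close> matters (convexity makes \<open>A\<close> sublinear on \<open>[0, t]\<close>) and its modular is at most \<open>C r\<^sup>n A t\<close>,
  while its mean oscillation on the ball of radius \<open>r\<close> is at least \<open>c t r\<^sup>s\<close>. If \<open>A t \<le> M t\<^sup>p\<close>, choosing
  \<open>C r\<^sup>n M t\<^sup>p = 1\<close> produces oscillation of size \<open>M\<^sup>-\<^sup>1\<^sup>/\<^sup>p\<close> on a ball of measure comparable to
  \<open>1 / (M t\<^sup>p)\<close>.
\<close>

section \<open>Measurability and monotonicity of Young functions\<close>

text \<open>Makes inner integrals over \<open>lebesgue\<close> measurable in the outer variable; a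
  countable cover for \<open>lborel\<close> keeps its measures under completion.\<close>

lemma sigma_finite_lebesgue: "sigma_finite_measure (lebesgue :: 'a::euclidean_space measure)"
proof
  obtain C :: "'a set set" where "countable C" "C \<subseteq> sets lborel" "\<Union>C = space lborel"
    "\<forall>a\<in>C. emeasure lborel a \<noteq> \<infinity>"
    using lborel.sigma_finite_countable by blast
  then show "\<exists>C. countable C \<and> C \<subseteq> sets (lebesgue :: 'a measure) \<and> \<Union>C = space lebesgue \<and>
      (\<forall>a\<in>C. emeasure lebesgue a \<noteq> \<infinity>)"
    by (intro exI[of _ C]) auto
qed

lemma young_function_scale:
  assumes "young_function A" "0 \<le> \<theta>" "\<theta> \<le> 1" "0 \<le> t"
  shows "A (\<theta> * t) \<le> ennreal \<theta> * A t"
proof -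
  have "A (\<theta> * t + (1 - \<theta>) * 0) \<le> ennreal \<theta> * A t + ennreal (1 - \<theta>) * A 0"
    using assms unfolding young_function_def by (meson atLeastAtMost_iff order_refl)
  then show ?thesis
    using assms by (simp add: young_function_def)
qed

lemma young_function_mono:
  assumes "young_function A" "0 \<le> a" "a \<le> b"
  shows "A a \<le> A b"
proof (cases "b = 0")
  case False
  then have "A (a / b * b) \<le> ennreal (a / b) * A b"
    using assms by (intro young_function_scale) auto
  also have "\<dots> \<le> 1 * A b"
    using assms False by (intro mult_right_mono) auto
  finally show ?thesis
    using False by simp
qed (use assms in auto)

text \<open>Superlevel sets of a monotone function are intervals.\<close>

lemma mono_borel_measurable_ennreal:
  fixes f :: "real \<Rightarrow> ennreal"
  assumes "mono f"
  shows "f \<in> borel_measurable borel"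
proof (rule borel_measurableI_greater)
  fix y
  have "is_interval {x. y < f x}"
    using assms unfolding is_interval_1 by (auto dest: monoD intro: less_le_trans)
  then show "{x \<in> space borel. y < f x} \<in> sets borel"
    by (simp add: real_interval_borel_measurable)
qed

text \<open>The absolute value is needed because \<open>A\<close> is arbitrary on the negative axis
  and may fail to be measurable there.\<close>

lemma young_function_borel_measurable:
  assumes "young_function A"
  shows "(\<lambda>t. A \<bar>t\<bar>) \<in> borel_measurable borel"
proof -
  have "mono (\<lambda>t. A (max 0 t))"
    using assms by (intro monoI young_function_mono) auto
  from mono_borel_measurable_ennreal[OF this]
  have "(\<lambda>t. A (max 0 \<bar>t\<bar>)) \<in> borel_measurable borel"
    by measurable
  then show ?thesis by simp
qed

section \<open>Upper bounds for the mean oscillation\<close>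

text \<open>The difference \<open>v x - average B v\<close> is the average over \<open>y\<close> of
  \<open>v x - v y\<close>, so averaging its absolute value over \<open>x\<close> gives the double
  integral. Local integrability is part of the conclusion because membership in
  \<open>V_space\<close> does not include it.\<close>

lemma mean_osc_le_double_integral:
  fixes v :: "real ^ 'n::finite \<Rightarrow> real"
  assumes v: "v \<in> borel_measurable lebesgue" and B: "B \<in> lmeasurable" "measure lebesgue B > 0"
    and fin: "(\<integral>\<^sup>+ y\<in>B. (\<integral>\<^sup>+ x\<in>B. ennreal \<bar>v x - v y\<bar> \<partial>lebesgue) \<partial>lebesgue) < \<infinity>"
  shows "set_integrable lebesgue B v"
    and "mean_osc B v \<le> (\<integral>\<^sup>+ y\<in>B. (\<integral>\<^sup>+ x\<in>B. ennreal \<bar>v x - v y\<bar> \<partial>lebesgue) \<partial>lebesgue)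
           / ennreal (measure lebesgue B ^ 2)"
proof -
  interpret L: sigma_finite_measure "lebesgue :: (real ^ 'n) measure"
    by (rule sigma_finite_lebesgue)
  note [measurable] = v
  have [measurable]: "B \<in> sets lebesgue" using B by (simp add: fmeasurableD)
  define m where "m = measure lebesgue B"
  have m: "m > 0" "emeasure lebesgue B = ennreal m"
    using B by (auto simp: m_def emeasure_eq_measure2)
  define D where "D y = (\<integral>\<^sup>+ x\<in>B. ennreal \<bar>v x - v y\<bar> \<partial>lebesgue)" for y
  have [measurable]: "D \<in> borel_measurable lebesgue"
    unfolding D_def by measurable
  \<comment> \<open>Were \<open>D\<close> infinite on all of \<open>B\<close>, a set of positive
    measure, the double integral would be infinite. One finite \<open>D y0\<close> suffices:
    \<open>v\<close> is then an integrable function plus the constant \<open>v y0\<close>.\<close>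
  have "\<exists>y\<in>B. D y < \<infinity>"
  proof (rule ccontr)
    assume "\<not> (\<exists>y\<in>B. D y < \<infinity>)"
    then have "(\<integral>\<^sup>+ y\<in>B. D y \<partial>lebesgue) = (\<integral>\<^sup>+ y\<in>B. \<infinity> \<partial>lebesgue)"
      by (intro nn_integral_cong) (auto simp: indicator_def less_top[symmetric])
    also have "\<dots> = \<infinity>"
      using m by (subst nn_integral_cmult_indicator) (auto simp: ennreal_top_mult simp del: emeasure_completion)
    finally show False using fin by (simp add: D_def)
  qed
  then obtain y0 where "y0 \<in> B" "D y0 < \<infinity>" by blast
  then have i: "set_integrable lebesgue B (\<lambda>x. v x - v y0)"
    unfolding set_integrable_def D_def
    by (intro integrableI_bounded) (auto simp: indicator_mult_ennreal abs_mult mult.commute)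
  have c: "set_integrable lebesgue B (\<lambda>x. c)" for c :: real
    using B unfolding set_integrable_def by (simp flip: lmeasurable_iff_integrable)
  have "set_integrable lebesgue B (\<lambda>x. (v x - v y0) + v y0)"
    using i c by (rule set_integral_add)
  then show vi: "set_integrable lebesgue B v" by simp
  have pt: "ennreal \<bar>v x - average B v\<bar> \<le> D x / ennreal m" for x
  proof -
    have "(LINT y:B|lebesgue. v x - v y) = m * v x - (LINT y:B|lebesgue. v y)"
      using c vi by (subst set_integral_diff(2)) (auto simp: m_def set_lebesgue_integral_def)
    then have "v x - average B v = (LINT y:B|lebesgue. v x - v y) / m"
      using m by (simp add: average_def m_def field_simps)
    moreover have "ennreal \<bar>LINT y:B|lebesgue. v x - v y\<bar> \<le> D x"
    proof -
      have "set_integrable lebesgue B (\<lambda>y. v x - v y)"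
        using c vi by (rule set_integral_diff)
      then have "ennreal (norm (LINT y:B|lebesgue. v x - v y)) \<le>
          (\<integral>\<^sup>+ y. ennreal (norm (indicator B y *\<^sub>R (v x - v y))) \<partial>lebesgue)"
        unfolding set_integrable_def set_lebesgue_integral_def
        by (rule integral_norm_bound_ennreal)
      also have "\<dots> = D x"
        unfolding D_def
        by (intro nn_integral_cong) (auto simp: indicator_def abs_minus_commute)
      finally show ?thesis by simp
    qed
    ultimately show ?thesis
      using m by (simp add: divide_right_mono_ennreal flip: divide_ennreal)
  qed
  have "(\<integral>\<^sup>+ x\<in>B. ennreal \<bar>v x - average B v\<bar> \<partial>lebesgue)
      \<le> (\<integral>\<^sup>+ x. (D x * indicator B x) / ennreal m \<partial>lebesgue)"
    using pt by (intro nn_integral_mono) (auto simp: indicator_def)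
  also have "\<dots> = (\<integral>\<^sup>+ x\<in>B. D x \<partial>lebesgue) / ennreal m"
    by (rule nn_integral_divide) measurable
  finally have "mean_osc B v \<le> (\<integral>\<^sup>+ x\<in>B. D x \<partial>lebesgue) / ennreal m / ennreal m"
    unfolding mean_osc_def m(2) by (rule divide_right_mono_ennreal)
  also have "\<dots> = (\<integral>\<^sup>+ x\<in>B. D x \<partial>lebesgue) / ennreal (m ^ 2)"
    using m(1) by (simp add: divide_ennreal_def power2_eq_square ennreal_mult
        ennreal_inverse_mult mult.assoc less_top[symmetric])
  finally show "mean_osc B v \<le> (\<integral>\<^sup>+ y\<in>B. (\<integral>\<^sup>+ x\<in>B. ennreal \<bar>v x - v y\<bar> \<partial>lebesgue) \<partial>lebesgue)
           / ennreal (measure lebesgue B ^ 2)"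
    by (simp add: D_def m_def)
qed

text \<open>Here \<open>a\<close> and \<open>h\<close> stand for |v x - v y| and |x - y|, and
  \<open>d\<close> for the diameter of the ball. On the diagonal \<open>a = 0\<close>, which falls
  under the first case.\<close>

lemma pointwise_oscillation_bound:
  fixes A :: "real \<Rightarrow> ennreal" and s p :: real and n :: nat
  assumes s: "0 < s" and p: "1 \<le> p" "s * p = real n"
    and T: "0 \<le> T" "0 < M" "\<And>t. T \<le> t \<Longrightarrow> 0 < t \<Longrightarrow> ennreal (M * t powr p) \<le> A t"
    and a: "0 \<le> a" "h = 0 \<Longrightarrow> a = 0" and h: "0 \<le> h" "h \<le> d" and e: "0 < e"
  shows "ennreal a \<le> ennreal (T * d powr s + e)
           + ennreal (e powr (1 - p) * d ^ (2 * n) / M) * (A (a / h powr s) / ennreal (h ^ n))"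
proof (cases "a \<le> T * h powr s")
  case True
  also have "T * h powr s \<le> T * d powr s"
    using T h s by (intro mult_left_mono powr_mono2) auto
  finally have "ennreal a \<le> ennreal (T * d powr s + e)"
    using e by (intro ennreal_leI) auto
  then show ?thesis by (rule add_increasing2[rotated]) simp
next
  case False
  with a T have "h \<noteq> 0" by auto
  with h have hp: "h > 0" by simp
  have ap: "a > 0" using False T hp
    by (smt (verit, best) mult_nonneg_nonneg powr_ge_zero)
  define q where "q = a / h powr s"
  have q: "q > 0" "T \<le> q"
    using False ap hp by (auto simp: q_def field_simps)
  \<comment> \<open>The relation \<open>s * p = n\<close> enters here: the p-th power of the
    quotient has the same weight \<open>h ^ n\<close> as the kernel, whence
    \<open>h ^ (2 * n)\<close> in the end.\<close>
  have qp: "q powr p = a powr p / h ^ n"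
    using ap hp p by (simp add: q_def powr_divide powr_powr powr_realpow)
  \<comment> \<open>If \<open>a > e\<close>, then (a / e)^(p - 1) is at least 1, and multiplying by
    \<open>a\<close> gives the second term alone.\<close>
  have "a \<le> e + e powr (1 - p) * a powr p"
  proof (cases "a \<le> e")
    case False
    then have "(e / a) powr (p - 1) \<le> 1"
      using e ap p by (intro powr_le1) auto
    then have "a * e powr (p - 1) \<le> a * a powr (p - 1)"
      using e ap by (simp add: powr_divide field_simps)
    also have "\<dots> = a powr p"
      using ap by (simp add: powr_mult_base)
    finally have "a \<le> a powr p / e powr (p - 1)"
      using e by (simp add: field_simps)
    moreover have "e powr (1 - p) = 1 / e powr (p - 1)"
      using powr_minus_divide[of e "p - 1"] by simp
    ultimately show ?thesis
      using e by simp
  qed (use e in \<open>auto intro: add_increasing2\<close>)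
  also have "e powr (1 - p) * a powr p \<le> e powr (1 - p) * d ^ (2 * n) / M * (M * q powr p / h ^ n)"
  proof -
    have "h ^ (2 * n) \<le> d ^ (2 * n)" using h by (intro power_mono) auto
    then have "a powr p * h ^ (2 * n) \<le> a powr p * d ^ (2 * n)" by (intro mult_left_mono) auto
    then have "a powr p \<le> d ^ (2 * n) * (q powr p / h ^ n)"
      using hp by (simp add: qp field_simps power_mult power2_eq_square flip: power_mult_distrib)
    then have "e powr (1 - p) * a powr p \<le> e powr (1 - p) * (d ^ (2 * n) * (q powr p / h ^ n))"
      by (intro mult_left_mono) auto
    then show ?thesis using T by simp
  qed
  finally have "a \<le> (T * d powr s + e) + e powr (1 - p) * d ^ (2 * n) / M * (M * q powr p / h ^ n)"
    using T by (smt (verit) mult_nonneg_nonneg powr_ge_zero)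
  then have "ennreal a \<le>
      ennreal ((T * d powr s + e) + e powr (1 - p) * d ^ (2 * n) / M * (M * q powr p / h ^ n))"
    by (rule ennreal_leI)
  also have "\<dots> = ennreal (T * d powr s + e)
      + ennreal (e powr (1 - p) * d ^ (2 * n) / M) * ennreal (M * q powr p / h ^ n)"
  proof -
    have "0 \<le> e powr (1 - p) * d ^ (2 * n) / M" "0 \<le> M * q powr p / h ^ n" "0 \<le> T * d powr s + e"
      using T(1,2) e h by auto
    then show ?thesis by (simp only: ennreal_plus ennreal_mult mult_nonneg_nonneg)
  qed
  also have "ennreal (M * q powr p / h ^ n) \<le> A q / ennreal (h ^ n)"
    using T(3)[OF q(2,1)] T(2) hp
    by (subst divide_ennreal[symmetric]) (auto intro: divide_right_mono_ennreal)
  finally show ?thesis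
    by (simp add: q_def add_left_mono mult_left_mono)
qed

text \<open>The pointwise bound is integrated over the square of the ball; the modular contributes
  at most 1, and division by the squared measure of the ball gives the estimate.\<close>

lemma
  fixes v :: "real ^ 'n::finite \<Rightarrow> real" and s :: real
  assumes s: "0 < s" "s < 1" and A: "young_function A"
    and v: "v \<in> borel_measurable lebesgue" and J: "J_fun s A v \<le> 1"
    and T: "0 \<le> T" "0 < M"
      "\<And>t. T \<le> t \<Longrightarrow> 0 < t \<Longrightarrow> ennreal (M * t powr (real CARD('n) / s)) \<le> A t"
    and r: "0 < r" and e: "0 < e"
  shows set_integrable_ball_if_J_le_1: "set_integrable lebesgue (ball z r) v"
    and mean_osc_ball_if_J_le_1: "mean_osc (ball z r) v
      \<le> ennreal (T * (2 * r) powr s + e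
           + e powr (1 - real CARD('n) / s) * 4 ^ CARD('n) / (unit_ball_vol (real CARD('n)) ^ 2 * M))"
proof -
  interpret L: sigma_finite_measure "lebesgue :: (real ^ 'n) measure"
    by (rule sigma_finite_lebesgue)
  note [measurable] = v young_function_borel_measurable[OF A]
  define n where "n = CARD('n)"
  have n: "n \<ge> 1" by (simp add: n_def Suc_leI)
  define p where "p = real n / s"
  have p: "1 \<le> p" "s * p = real n"
    using s n by (auto simp: p_def field_simps intro: order_trans[of s 1])
  define B where "B = ball z r"
  define m where "m = measure lebesgue B"
  have meq: "m = unit_ball_vol (real n) * r ^ n"
    using r by (simp add: m_def B_def n_def content_ball)
  have mpos: "m > 0" using r by (simp add: meq)
  have BL: "B \<in> lmeasurable" by (simp add: B_def)
  have [measurable]: "B \<in> sets lebesgue" using BL by (simp add: fmeasurableD)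
  have em: "emeasure lebesgue B = ennreal m"
    unfolding m_def using BL by (simp add: emeasure_eq_measure2)
  define c where "c = T * (2 * r) powr s + e"
  have c: "c \<ge> 0" using T e by (simp add: c_def)
  define K where "K = e powr (1 - p) * (2 * r) ^ (2 * n) / M"
  have K: "K \<ge> 0" using T r by (simp add: K_def)
  define F where "F x y = A (\<bar>v x - v y\<bar> / norm (x - y) powr s) / ennreal (norm (x - y) ^ n)" for x y
  have Fm: "(\<lambda>(x, y). F x y) \<in> borel_measurable (lebesgue \<Otimes>\<^sub>M lebesgue)"
  proof -
    have id: "(\<lambda>x :: real ^ 'n. x) \<in> lebesgue \<rightarrow>\<^sub>M borel"
      by (intro measurable_completion) simp
    have [measurable]: "fst \<in> borel_measurable (lebesgue \<Otimes>\<^sub>M lebesgue :: ((real ^ 'n) \<times> (real ^ 'n)) measure)"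
      "snd \<in> borel_measurable (lebesgue \<Otimes>\<^sub>M lebesgue :: ((real ^ 'n) \<times> (real ^ 'n)) measure)"
      using measurable_compose[OF measurable_fst id] measurable_compose[OF measurable_snd id] by auto
    \<comment> \<open>The outer absolute value does not change the nonnegative quotient; it brings
      in the Borel function \<open>A \<bar>t\<bar>\<close>.\<close>
    have "(\<lambda>(x, y). A \<bar>\<bar>v x - v y\<bar> / norm (x - y) powr s\<bar> / ennreal (norm (x - y) ^ n))
        \<in> borel_measurable (lebesgue \<Otimes>\<^sub>M lebesgue)"
      by measurable
    then show ?thesis by (simp add: F_def)
  qed
  have [measurable]: "(\<lambda>x. F x y) \<in> borel_measurable lebesgue" for y
    using Fm by measurable
  have Jm [measurable]: "(\<lambda>y. \<integral>\<^sup>+ x. F x y \<partial>lebesgue) \<in> borel_measurable lebesgue"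
    using measurable_pair_swap[OF Fm] by (intro L.borel_measurable_nn_integral) (simp add: split_def)
  have pt: "ennreal \<bar>v x - v y\<bar> \<le> ennreal c + ennreal K * F x y" if "x \<in> B" "y \<in> B" for x y
    unfolding c_def K_def F_def
  proof (rule pointwise_oscillation_bound[OF s(1) p T(1,2) T(3)[folded n_def, folded p_def]])
    have "dist x y \<le> dist z x + dist z y" by (metis dist_commute dist_triangle)
    then show "norm (x - y) \<le> 2 * r" using that by (simp add: B_def dist_norm[symmetric])
  qed (use e in auto)
  have inner: "(\<integral>\<^sup>+ x\<in>B. ennreal \<bar>v x - v y\<bar> \<partial>lebesgue)
      \<le> ennreal c * ennreal m + ennreal K * (\<integral>\<^sup>+ x. F x y \<partial>lebesgue)" if "y \<in> B" for y
  proof -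
    have "(\<integral>\<^sup>+ x\<in>B. ennreal \<bar>v x - v y\<bar> \<partial>lebesgue)
        \<le> (\<integral>\<^sup>+ x. ennreal c * indicator B x + ennreal K * F x y \<partial>lebesgue)"
      using pt[OF _ that] by (intro nn_integral_mono) (auto simp: indicator_def)
    also have "\<dots> = ennreal c * emeasure lebesgue B + ennreal K * (\<integral>\<^sup>+ x. F x y \<partial>lebesgue)"
      by (subst nn_integral_add) (auto simp: nn_integral_cmult nn_integral_cmult_indicator
          simp del: emeasure_completion)
    finally show ?thesis by (simp add: em)
  qed
  have "(\<integral>\<^sup>+ y\<in>B. (\<integral>\<^sup>+ x\<in>B. ennreal \<bar>v x - v y\<bar> \<partial>lebesgue) \<partial>lebesgue)
      \<le> (\<integral>\<^sup>+ y. (ennreal c * ennreal m) * indicator B y + ennreal K * (\<integral>\<^sup>+ x. F x y \<partial>lebesgue) \<partial>lebesgue)"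
    using inner by (intro nn_integral_mono) (auto simp: indicator_def)
  also have "\<dots> = (ennreal c * ennreal m) * emeasure lebesgue B
      + ennreal K * (\<integral>\<^sup>+ y. (\<integral>\<^sup>+ x. F x y \<partial>lebesgue) \<partial>lebesgue)"
    by (subst nn_integral_add) (auto simp: nn_integral_cmult nn_integral_cmult_indicator
          simp del: emeasure_completion)
  also have "\<dots> \<le> (ennreal c * ennreal m) * ennreal m + ennreal K * 1"
    unfolding em using J by (intro add_left_mono mult_left_mono) (auto simp: J_fun_def F_def n_def)
  also have "\<dots> = ennreal (c * m ^ 2 + K)"
    using c K mpos by (simp add: ennreal_mult power2_eq_square mult.assoc)
  finally have D: "(\<integral>\<^sup>+ y\<in>B. (\<integral>\<^sup>+ x\<in>B. ennreal \<bar>v x - v y\<bar> \<partial>lebesgue) \<partial>lebesgue)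
      \<le> ennreal (c * m ^ 2 + K)" .
  then have "(\<integral>\<^sup>+ y\<in>B. (\<integral>\<^sup>+ x\<in>B. ennreal \<bar>v x - v y\<bar> \<partial>lebesgue) \<partial>lebesgue) < \<infinity>"
    by (rule le_less_trans) simp
  note osc = mean_osc_le_double_integral[OF v BL mpos[unfolded m_def] this, folded m_def]
  show "set_integrable lebesgue (ball z r) v"
    using osc(1) by (simp add: B_def)
  have "mean_osc B v \<le> ennreal (c * m ^ 2 + K) / ennreal (m ^ 2)"
    using osc(2) D by (blast intro: order_trans divide_right_mono_ennreal)
  also have "\<dots> = ennreal (c + K / m ^ 2)"
    using c K mpos by (subst divide_ennreal) (auto simp: add_divide_distrib)
  \<comment> \<open>The radius cancels: (2r)^(2n) is divided by the square of a multiple of r^n.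
    This scale invariance is what makes the exponent n / s critical.\<close>
  also have "K / m ^ 2 = e powr (1 - p) * 4 ^ n / (unit_ball_vol (real n) ^ 2 * M)"
  proof -
    have "(2 * r) ^ (2 * n) = ((2 * r) ^ 2) ^ n"
      by (rule power_mult)
    also have "\<dots> = 4 ^ n * (r ^ 2) ^ n"
      by (simp add: power_mult_distrib)
    also have "(r ^ 2) ^ n = (r ^ n) ^ 2"
      by (metis power_mult mult.commute)
    finally have "K / m ^ 2 = e powr (1 - p) * (4 ^ n * (r ^ n) ^ 2) / M / (unit_ball_vol (real n) ^ 2 * (r ^ n) ^ 2)"
      by (simp add: K_def meq power_mult_distrib)
    then show ?thesis
      using r by simp
  qed
  finally show "mean_osc (ball z r) v
      \<le> ennreal (T * (2 * r) powr s + e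
           + e powr (1 - real CARD('n) / s) * 4 ^ CARD('n) / (unit_ball_vol (real CARD('n)) ^ 2 * M))"
    by (simp add: c_def B_def n_def p_def)
qed

section \<open>Tent functions: kernel integral, modular and oscillation\<close>

text \<open>Inside radius \<open>r\<close> the kernel is r^(s-1) |h|^(1-s-n), integrable at 0
  because \<open>s < 1\<close>; outside it is r^s |h|^(-s-n), integrable at infinity because
  \<open>s > 0\<close>. Both integrals are invariant under scaling in \<open>r\<close>.\<close>

lemma truncated_kernel_integral_bound:
  fixes s :: real
  assumes "0 < s" "s < 1"
  obtains K :: real where "K > 0"
    "\<And>r. r > 0 \<Longrightarrow> (\<integral>\<^sup>+ h. ennreal (r powr (s - 1) * min (norm h) r
        / norm h powr (s + real CARD('n))) \<partial>(lborel :: (real ^ 'n::finite) measure)) \<le> ennreal K"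
proof -
  define n where "n = real CARD('n)"
  have n: "n \<ge> 1" by (simp add: n_def Suc_leI)
  define \<omega> where "\<omega> = unit_ball_vol n"
  have \<omega>: "\<omega> > 0" using n by (simp add: \<omega>_def)
  \<comment> \<open>The k-th inner and outer contributions: a bound of the kernel on the annulus
    times the volume of the enclosing ball. The ratios 2^(s-1) and 2^(-s) are below 1.\<close>
  define a where "a k = \<omega> * 2 powr (s + n - 1) * (2 powr (s - 1)) ^ k + \<omega> * 2 powr n * (2 powr (-s)) ^ k" for k :: nat
  have a0: "a k \<ge> 0" for k using \<omega> by (simp add: a_def)
  have q: "2 powr (s - 1) < (1 :: real)" "2 powr (- s) < (1 :: real)"
    using assms by (auto intro!: powr_less_one)
  have sa: "summable a"
    unfolding a_def using q by (intro summable_add summable_mult summable_geometric) auto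
  show ?thesis
  \<comment> \<open>The summand 1 secures strict positivity from nonnegativity of the
    series.\<close>
  proof (rule that[of "suminf a + 1"])
    show "suminf a + 1 > 0" using suminf_nonneg[OF sa a0] by simp
  next
    fix r :: real assume r: "r > 0"
    \<comment> \<open>The terms of \<open>G\<close> majorize the kernel on the dyadic annuli inside and outside radius \<open>r\<close>.\<close>
    define R where "R = log 2 r"
    have rR: "r = 2 powr R" using r by (simp add: R_def)
    define c where "c k = r powr (- n) * 2 powr ((real k + 1) * (s + n - 1))" for k
    define d where "d k = r powr (- n) * 2 powr (- real k * (s + n))" for k
    define G where "G h = (\<Sum>k. ennreal (c k) * indicator (ball 0 (r * 2 powr (- real k))) h
      + ennreal (d k) * indicator (ball 0 (r * 2 powr (real k + 1))) h)" for h :: "real ^ 'n"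
    have ball: "emeasure lborel (ball (0 :: real ^ 'n) \<rho>) = ennreal (\<omega> * \<rho> powr n)" if "\<rho> > 0" for \<rho>
      using that by (simp add: emeasure_ball \<omega>_def n_def powr_realpow)
    have [measurable]: "ball (0 :: real ^ 'n) \<rho> \<in> sets borel" for \<rho> by simp
    have gk: "(\<integral>\<^sup>+ h. ennreal (c k) * indicator (ball 0 (r * 2 powr (- real k))) h
        + ennreal (d k) * indicator (ball 0 (r * 2 powr (real k + 1))) h \<partial>(lborel :: (real ^ 'n) measure))
      = ennreal (c k) * ennreal (\<omega> * (r * 2 powr (- real k)) powr n)
        + ennreal (d k) * ennreal (\<omega> * (r * 2 powr (real k + 1)) powr n)" for k
      using r by (subst nn_integral_add) (simp_all add: nn_integral_cmult_indicator ball)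
    have "ennreal (r powr (s - 1) * min (norm h) r / norm h powr (s + n)) \<le> G h" for h :: "real ^ 'n"
    proof (cases "h = 0")
      case False
      define L where "L = log 2 (norm h / r)"
      have hL: "norm h = r * 2 powr L" using False r by (simp add: L_def)
      have summand: "ennreal (c k) * indicator (ball 0 (r * 2 powr (- real k))) h
          + ennreal (d k) * indicator (ball 0 (r * 2 powr (real k + 1))) h \<le> G h" for k
        unfolding G_def
        by (rule order_trans[OF _ sum_le_suminf[of _ "{k}"]]) auto
      show ?thesis
      proof (cases "L < 0")
        case True
        \<comment> \<open>Ceiling minus one, rather than floor, gives the strict
          \<open>L < - k\<close>, so that \<open>h\<close> lies in the open ball even when
          \<open>L\<close> is an integer.\<close>
        define k where "k = nat (\<lceil>- L\<rceil> - 1)"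
        have k: "real k = of_int \<lceil>- L\<rceil> - 1"
          using True by (simp add: k_def)
        have "- L \<le> real k + 1" "L < - real k" using k by linarith+
        have "r * 2 powr L < r" using True r by (simp add: powr_less_one)
        then have "r powr (s - 1) * min (norm h) r / norm h powr (s + n)
            = r powr (s - 1) * (r * 2 powr L) / (r * 2 powr L) powr (s + n)"
          by (simp add: hL)
        also have "\<dots> = r powr (- n) * 2 powr (- L * (s + n - 1))"
          unfolding rR by (simp add: powr_powr flip: powr_add powr_diff)
            (rule arg_cong[where f = "(powr) 2"], simp add: algebra_simps)
        also have "\<dots> \<le> c k"
          unfolding c_def using \<open>- L \<le> real k + 1\<close> n assms
          by (intro mult_left_mono powr_mono mult_right_mono) auto
        finally have "ennreal (r powr (s - 1) * min (norm h) r / norm h powr (s + n)) \<le> ennreal (c k)"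
          by (rule ennreal_leI)
        also have "h \<in> ball 0 (r * 2 powr (- real k))"
          using r \<open>L < - real k\<close> by (simp add: hL)
        then have "ennreal (c k) \<le> G h"
          using summand[of k] by (auto intro: order_trans[rotated] add_increasing2)
        finally show ?thesis .
      next
        case False
        define k where "k = nat \<lfloor>L\<rfloor>"
        have k: "real k = of_int \<lfloor>L\<rfloor>"
          using False by (simp add: k_def)
        have "real k \<le> L" "L < real k + 1" using k by linarith+
        have "r \<le> r * 2 powr L" using False r by (simp add: ge_one_powr_ge_zero)
        then have "r powr (s - 1) * min (norm h) r / norm h powr (s + n)
            = r powr (s - 1) * r / (r * 2 powr L) powr (s + n)"
          by (simp add: hL)
        also have "\<dots> = r powr (- n) * 2 powr (- L * (s + n))"
          unfolding rR by (simp add: powr_powr flip: powr_add powr_diff)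
            (rule arg_cong[where f = "(powr) 2"], simp add: algebra_simps)
        also have "\<dots> \<le> d k"
          unfolding d_def using \<open>real k \<le> L\<close> n assms
          by (intro mult_left_mono powr_mono mult_right_mono) auto
        finally have "ennreal (r powr (s - 1) * min (norm h) r / norm h powr (s + n)) \<le> ennreal (d k)"
          by (rule ennreal_leI)
        also have "h \<in> ball 0 (r * 2 powr (real k + 1))"
          using r \<open>L < real k + 1\<close> by (simp add: hL)
        then have "ennreal (d k) \<le> G h"
          using summand[of k] by (auto intro: order_trans[rotated] add_increasing)
        finally show ?thesis .
      qed
    qed simp
    then have "(\<integral>\<^sup>+ h. ennreal (r powr (s - 1) * min (norm h) r / norm h powr (s + n)) \<partial>(lborel :: (real ^ 'n) measure))
        \<le> (\<integral>\<^sup>+ h. G h \<partial>(lborel :: (real ^ 'n) measure))"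
      by (rule nn_integral_mono)
    also have "\<dots> = (\<Sum>k. ennreal (c k) * ennreal (\<omega> * (r * 2 powr (- real k)) powr n)
      + ennreal (d k) * ennreal (\<omega> * (r * 2 powr (real k + 1)) powr n))"
      unfolding G_def using gk by (subst nn_integral_suminf) simp_all
    also have "\<dots> = (\<Sum>k. ennreal (a k))"
    proof (rule arg_cong[where f = suminf], rule ext)
      fix k
      have c1: "c k * (\<omega> * (r * 2 powr (- real k)) powr n) = \<omega> * 2 powr (s + n - 1) * (2 powr (s - 1)) ^ k"
        unfolding c_def rR
        by (simp add: powr_powr powr_power flip: powr_add) (simp add: algebra_simps flip: powr_add)
      have d1: "d k * (\<omega> * (r * 2 powr (real k + 1)) powr n) = \<omega> * 2 powr n * (2 powr (-s)) ^ k"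
        unfolding d_def rR
        by (simp add: powr_powr powr_power flip: powr_add) (simp add: algebra_simps flip: powr_add)
      have "0 \<le> c k" "0 \<le> d k" "0 \<le> \<omega>" using \<omega> by (auto simp: c_def d_def)
      then show "ennreal (c k) * ennreal (\<omega> * (r * 2 powr (- real k)) powr n)
          + ennreal (d k) * ennreal (\<omega> * (r * 2 powr (real k + 1)) powr n) = ennreal (a k)"
        by (simp add: ennreal_mult[symmetric] c1 d1 a_def)
    qed
    also have "\<dots> = ennreal (suminf a)"
      using a0 sa by (rule suminf_ennreal2)
    also have "\<dots> \<le> ennreal (suminf a + 1)" by (intro ennreal_leI) simp
    finally show "(\<integral>\<^sup>+ h. ennreal (r powr (s - 1) * min (norm h) r
        / norm h powr (s + real CARD('n))) \<partial>(lborel :: (real ^ 'n) measure)) \<le> ennreal (suminf a + 1)"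
      by (simp add: n_def)
  qed
qed

definition tent :: "real \<Rightarrow> real \<Rightarrow> real \<Rightarrow> real ^ 'n::finite \<Rightarrow> real" where
  "tent s r t x = t * r powr (s - 1) * max 0 (r - norm x)"

lemma tent_borel_measurable: "tent s r t \<in> borel_measurable lebesgue"
  unfolding tent_def by (intro measurable_completion) measurable

text \<open>The slope controls near points and the height controls far ones, hence the
  minimum.\<close>

lemma tent_diff_le:
  assumes "0 < r" "0 \<le> t"
  shows "\<bar>tent s r t x - tent s r t y\<bar> \<le> t * (r powr (s - 1) * min (norm (x - y)) r)"
proof -
  have "\<bar>max 0 (r - norm x) - max 0 (r - norm y)\<bar> \<le> min (norm (x - y)) r"
    using norm_triangle_ineq3[of x y] assms norm_ge_zero[of x] norm_ge_zero[of y] by linarith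
  then have "t * r powr (s - 1) * \<bar>max 0 (r - norm x) - max 0 (r - norm y)\<bar>
      \<le> t * r powr (s - 1) * min (norm (x - y)) r"
    using assms by (intro mult_left_mono) auto
  then show ?thesis
    using assms by (simp add: tent_def abs_mult flip: right_diff_distrib)
qed

text \<open>Writing the quotient as at most \<open>\<theta> * t\<close> with
  \<open>\<theta> \<le> 1\<close>, convexity pulls out the factor \<open>\<theta>\<close> and leaves
  \<open>A t\<close> times the truncated kernel. The integrand vanishes unless \<open>x\<close> or
  \<open>y\<close> lies in the support ball; the two possibilities account for the factor 2.\<close>

lemma J_fun_tent_le:
  fixes s r t K :: real
  assumes s: "0 < s" "s < 1" and A: "young_function A" and r: "0 < r" and t: "0 \<le> t"
    and K: "0 \<le> K" "(\<integral>\<^sup>+ h. ennreal (r powr (s - 1) * min (norm h) r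
        / norm h powr (s + real CARD('n))) \<partial>(lborel :: (real ^ 'n::finite) measure)) \<le> ennreal K"
  shows "J_fun s A (tent s r t :: real ^ 'n \<Rightarrow> real)
    \<le> A t * ennreal (2 * K * unit_ball_vol (real CARD('n)) * r ^ CARD('n))"
proof -
  define n where "n = CARD('n)"
  define k where "k h = ennreal (r powr (s - 1) * min (norm h) r / norm h powr (s + real n))" for h :: "real ^ 'n"
  define B where "B = ball (0 :: real ^ 'n) r"
  define m where "m = unit_ball_vol (real n) * r ^ n"
  have m: "emeasure lborel B = ennreal m" "0 \<le> m"
    using r by (auto simp: m_def B_def n_def emeasure_ball)
  have [measurable]: "k \<in> borel_measurable borel" unfolding k_def by measurable
  have [measurable]: "B \<in> sets borel" by (simp add: B_def)
  have int: "(\<integral>\<^sup>+ x. k (x - y) \<partial>lborel) \<le> ennreal K" for y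
  proof -
    have "(\<integral>\<^sup>+ x. k (x - y) \<partial>lborel) = (\<integral>\<^sup>+ x. k (x - y) \<partial>distr lborel borel ((+) y))"
      by (simp add: lborel_distr_plus)
    also have "\<dots> = (\<integral>\<^sup>+ x. k x \<partial>lborel)"
      by (subst nn_integral_distr) auto
    finally show ?thesis using K(2) by (simp add: k_def n_def)
  qed
  have int': "(\<integral>\<^sup>+ y. k (x - y) \<partial>lborel) \<le> ennreal K" for x
    using int[of x] by (simp add: k_def norm_minus_commute)
  let ?u = "tent s r t :: real ^ 'n \<Rightarrow> real"
  have pt: "A (\<bar>?u x - ?u y\<bar> / norm (x - y) powr s) / ennreal (norm (x - y) ^ n)
      \<le> A t * (k (x - y) * indicator B x + k (x - y) * indicator B y)" for x y
  proof (cases "x = y \<or> x \<notin> B \<and> y \<notin> B")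
    case True
    then have "?u x = ?u y" by (auto simp: tent_def B_def)
    then show ?thesis using A by (simp add: young_function_def)
  next
    case False
    define h where "h = norm (x - y)"
    have h: "h > 0" using False by (simp add: h_def)
    define \<theta> where "\<theta> = r powr (s - 1) * min h r / h powr s"
    have \<theta>: "0 \<le> \<theta>" "\<theta> \<le> 1"
    proof -
      show "0 \<le> \<theta>" using h r by (simp add: \<theta>_def)
      \<comment> \<open>In the two ranges \<open>\<theta>\<close> is (h / r)^(1 - s) and (r /
        h)^s.\<close>
      show "\<theta> \<le> 1"
      proof (cases "h \<le> r")
        case True
        then have "(h / r) powr (1 - s) \<le> 1" using h s by (intro powr_le1) auto
        moreover have "\<theta> = (h / r) powr (1 - s)"
          using h r True by (simp add: \<theta>_def powr_divide powr_diff field_simps)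
        ultimately show ?thesis by simp
      next
        case False
        then have "(r / h) powr s \<le> 1" using h r s by (intro powr_le1) auto
        moreover have "\<theta> = (r / h) powr s"
          using h r False by (simp add: \<theta>_def powr_divide powr_diff field_simps)
        ultimately show ?thesis by simp
      qed
    qed
    have "A (\<bar>?u x - ?u y\<bar> / h powr s) \<le> A (\<theta> * t)"
    proof (rule young_function_mono[OF A])
      show "\<bar>?u x - ?u y\<bar> / h powr s \<le> \<theta> * t"
        using divide_right_mono[OF tent_diff_le[OF r t, of s x y], of "h powr s"]
        by (simp add: \<theta>_def h_def mult.commute)
    qed simp
    also have "\<dots> \<le> ennreal \<theta> * A t" using young_function_scale[OF A \<theta> t] .
    finally have "A (\<bar>?u x - ?u y\<bar> / h powr s) / ennreal (h ^ n) \<le> ennreal \<theta> * A t / ennreal (h ^ n)"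
      by (rule divide_right_mono_ennreal)
    also have "\<dots> = A t * (ennreal \<theta> / ennreal (h ^ n))"
      by (simp add: ennreal_times_divide mult.commute)
    also have "ennreal \<theta> / ennreal (h ^ n) = k (x - y)"
      using \<theta> h by (simp add: divide_ennreal k_def \<theta>_def powr_add powr_realpow flip: h_def)
    also have "\<dots> \<le> k (x - y) * indicator B x + k (x - y) * indicator B y"
      using False by (auto simp: indicator_def)
    finally show ?thesis by (simp add: h_def mult_left_mono)
  qed
  have "J_fun s A ?u \<le> (\<integral>\<^sup>+ y. (\<integral>\<^sup>+ x. A t * (k (x - y) * indicator B x + k (x - y) * indicator B y)
      \<partial>lebesgue) \<partial>lebesgue)"
    unfolding J_fun_def n_def[symmetric] by (intro nn_integral_mono pt)
  also have "\<dots> = (\<integral>\<^sup>+ y. (\<integral>\<^sup>+ x. A t * (k (x - y) * indicator B x + k (x - y) * indicator B y)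
      \<partial>lborel) \<partial>lborel)"
    by (simp add: nn_integral_completion)
  also have "\<dots> = A t * ((\<integral>\<^sup>+ y. (\<integral>\<^sup>+ x. k (x - y) * indicator B x \<partial>lborel) \<partial>lborel)
      + (\<integral>\<^sup>+ y. (\<integral>\<^sup>+ x. k (x - y) * indicator B y \<partial>lborel) \<partial>lborel))"
    by (simp add: nn_integral_cmult nn_integral_add)
  \<comment> \<open>The indicator depends on the inner variable; after the exchange it is constant
    inside and \<open>int'\<close> applies.\<close>
  also have "(\<integral>\<^sup>+ y. (\<integral>\<^sup>+ x. k (x - y) * indicator B x \<partial>lborel) \<partial>lborel)
      = (\<integral>\<^sup>+ x. (\<integral>\<^sup>+ y. k (x - y) * indicator B x \<partial>lborel) \<partial>lborel)"
    by (rule lborel_pair.Fubini') measurable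
  also have "\<dots> \<le> (\<integral>\<^sup>+ x. ennreal K * indicator B x \<partial>lborel)"
    using int' by (intro nn_integral_mono) (simp add: nn_integral_multc mult_right_mono)
  also have "\<dots> = ennreal K * ennreal m"
    by (simp add: nn_integral_cmult_indicator m)
  also have "(\<integral>\<^sup>+ y. (\<integral>\<^sup>+ x. k (x - y) * indicator B y \<partial>lborel) \<partial>lborel)
      \<le> (\<integral>\<^sup>+ x. ennreal K * indicator B x \<partial>lborel)"
    using int by (intro nn_integral_mono) (simp add: nn_integral_multc mult_right_mono)
  also have "\<dots> = ennreal K * ennreal m"
    by (simp add: nn_integral_cmult_indicator m)
  also have "ennreal K * ennreal m + ennreal K * ennreal m = ennreal (2 * K * unit_ball_vol (real n) * r ^ n)"
    using K(1) m(2) by (simp add: m_def ennreal_mult[symmetric] ennreal_plus[symmetric] del: ennreal_plus)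
  finally show ?thesis by (simp add: n_def add_mono mult_left_mono)
qed

lemma mean_osc_tent_ge:
  fixes s r t :: real
  assumes r: "0 < r" and t: "0 \<le> t"
  shows "ennreal (t * r powr s / (8 * 4 ^ CARD('n)))
    \<le> mean_osc (ball 0 r) (tent s r t :: real ^ 'n::finite \<Rightarrow> real)"
proof -
  define n where "n = CARD('n)"
  let ?u = "tent s r t :: real ^ 'n \<Rightarrow> real"
  define \<alpha> where "\<alpha> = average (ball 0 r) ?u"
  define m where "m = unit_ball_vol (real n) * r ^ n"
  have m: "emeasure lebesgue (ball (0 :: real ^ 'n) r) = ennreal m" "0 < m"
    using r by (auto simp: m_def n_def emeasure_ball)
  \<comment> \<open>One eighth of the height of the tent: 3/4 and 1/2 of the height are
    \<open>6 * c\<close> and \<open>4 * c\<close>, and the threshold \<open>5 * c\<close> lies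
    midway.\<close>
  define c where "c = t * r powr s / 8"
  have c: "0 \<le> c" using t by (simp add: c_def)
  have c8: "t * r powr (s - 1) * r = 8 * c"
    using r by (simp add: c_def powr_diff)
  \<comment> \<open>Any coordinate axis serves. At distance 3r/4 the ball of radius r/4 fits between
    the spheres of radii r/2 and \<open>r\<close>.\<close>
  define b where "b = (3 / 4 * r) *\<^sub>R axis (undefined :: 'n) (1 :: real)"
  have b: "norm b = 3 / 4 * r" using r by (simp add: b_def)
  have u: "\<bar>?u x - \<alpha>\<bar> \<ge> c" if "x \<in> ball 0 (r / 4)" "\<alpha> \<le> 5 * c" for x
  proof -
    have "3 / 4 * r \<le> max 0 (r - norm x)"
      using that(1) by (simp add: max_def)
    then have "t * r powr (s - 1) * (3 / 4 * r) \<le> ?u x"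
      unfolding tent_def using t by (intro mult_left_mono) auto
    then show ?thesis using c8 that(2) by (simp add: mult.assoc[symmetric])
  qed
  have u': "\<bar>?u x - \<alpha>\<bar> \<ge> c" if "x \<in> ball b (r / 4)" "\<alpha> > 5 * c" for x
  proof -
    have "norm b \<le> norm (b - x) + norm x" by (metis add.commute norm_triangle_sub)
    then have "max 0 (r - norm x) \<le> r / 2"
      using that(1) b r by (simp add: dist_norm max_def)
    then have "?u x \<le> t * r powr (s - 1) * (r / 2)"
      unfolding tent_def using t by (intro mult_left_mono) auto
    then show ?thesis using c8 that(2) by simp
  qed
  \<comment> \<open>Near the centre the tent is at least \<open>6 c\<close>, on the ball around \<open>b\<close> at most \<open>4 c\<close>, so one of
    the two balls is far from \<open>\<alpha>\<close>.\<close>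
  obtain z where z: "ball z (r / 4) \<subseteq> ball 0 r" "\<And>x. x \<in> ball z (r / 4) \<Longrightarrow> \<bar>?u x - \<alpha>\<bar> \<ge> c"
  proof (cases "\<alpha> \<le> 5 * c")
    case True
    then show ?thesis using u r by (intro that[of 0]) auto
  next
    case False
    have "ball b (r / 4) \<subseteq> ball 0 r"
      using b by (simp add: ball_subset_ball_iff)
    then show ?thesis using u' False by (intro that[of b]) auto
  qed
  \<comment> \<open>A ball of a quarter of the radius carries the fraction 4^(-n) of the
    measure.\<close>
  have "ennreal (c * (m / 4 ^ n)) = ennreal c * emeasure lebesgue (ball z (r / 4))"
    using c m r by (simp add: emeasure_ball m_def n_def power_divide flip: ennreal_mult)
  also have "\<dots> = (\<integral>\<^sup>+ x. ennreal c * indicator (ball z (r / 4)) x \<partial>lebesgue)"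
    by (subst nn_integral_cmult_indicator) auto
  also have "\<dots> \<le> (\<integral>\<^sup>+ x\<in>ball 0 r. ennreal \<bar>?u x - \<alpha>\<bar> \<partial>lebesgue)"
    using z by (intro nn_integral_mono) (auto simp: indicator_def intro: ennreal_leI)
  finally have "ennreal (c * (m / 4 ^ n)) / ennreal m \<le> mean_osc (ball 0 r) ?u"
    unfolding mean_osc_def m(1) \<alpha>_def by (rule divide_right_mono_ennreal)
  then show ?thesis
    using c m by (simp add: divide_ennreal c_def n_def)
qed

section \<open>Unit-seminorm functions with large oscillation\<close>

lemma V_seminorm_le_1:
  assumes "J_fun s A u \<le> 1"
  shows "V_seminorm s A u \<le> 1"
  unfolding V_seminorm_def by (rule INF_lower2[of 1]) (use assms in auto)

text \<open>The parameters act separately: the size of the oscillation depends on \<open>M\<close>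
  alone, while \<open>t\<close> only shrinks the ball. Small \<open>M\<close> contradicts a BMO
  bound; fixed \<open>M\<close> with \<open>t\<close> tending to infinity contradicts a uniform VMO
  bound.\<close>

lemma large_oscillation_functions:
  fixes s :: real
  assumes s: "0 < s" "s < 1" and A: "young_function A"
  obtains Q \<kappa> :: real where "Q > 0" "\<kappa> > 0"
    "\<And>M t. M > 0 \<Longrightarrow> t > 0 \<Longrightarrow> A t \<le> ennreal (M * t powr (real CARD('n) / s)) \<Longrightarrow>
       \<exists>u \<in> V_space s A :: (real ^ 'n::finite \<Rightarrow> real) set. V_seminorm s A u \<le> 1 \<and>
         (\<exists>B\<in>balls. emeasure lebesgue B \<le> ennreal (Q / (M * t powr (real CARD('n) / s))) \<and>
            ennreal (\<kappa> * M powr (- s / real CARD('n))) \<le> mean_osc B u)"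
proof -
  define n where "n = CARD('n)"
  have n: "n > 0" by (simp add: n_def)
  define p where "p = real n / s"
  define \<omega> where "\<omega> = unit_ball_vol (real n)"
  have \<omega>: "\<omega> > 0" by (simp add: \<omega>_def)
  obtain K :: real where K: "K > 0"
    "\<And>r. r > 0 \<Longrightarrow> (\<integral>\<^sup>+ h. ennreal (r powr (s - 1) * min (norm h) r
        / norm h powr (s + real CARD('n))) \<partial>(lborel :: (real ^ 'n) measure)) \<le> ennreal K"
    using truncated_kernel_integral_bound[OF s, where 'n='n] by blast
  define Q where "Q = 1 / (2 * K)"
  define \<kappa> where "\<kappa> = (2 * K * \<omega>) powr (- s / n) / (8 * 4 ^ n)"
  show ?thesis
  proof (rule that[of Q \<kappa>])
    show "Q > 0" "\<kappa> > 0" using K \<omega> by (auto simp: Q_def \<kappa>_def)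
  next
    fix M t :: real
    assume M: "M > 0" and t: "t > 0" and At: "A t \<le> ennreal (M * t powr (real CARD('n) / s))"
    \<comment> \<open>With \<open>r ^ n = 1 / N\<close> the bound for the modular becomes exactly
      1.\<close>
    define N where "N = 2 * K * \<omega> * M * t powr p"
    have N: "N > 0" using K \<omega> M t by (simp add: N_def)
    define r where "r = N powr (- 1 / n)"
    have r: "r > 0" using N by (simp add: r_def)
    have rn: "r ^ n = 1 / N"
      unfolding r_def using N n by (subst powr_power) (auto simp: powr_neg_one)
    let ?u = "tent s r t :: real ^ 'n \<Rightarrow> real"
    have "J_fun s A ?u \<le> A t * ennreal (2 * K * \<omega> * r ^ n)"
      using J_fun_tent_le[OF s A r, of t K, where 'n='n] K r t by (simp add: \<omega>_def n_def)
    also have "\<dots> \<le> ennreal (M * t powr p) * ennreal (2 * K * \<omega> * r ^ n)"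
      using At by (intro mult_right_mono) (auto simp: p_def n_def)
    also have "\<dots> = ennreal (M * t powr p * (2 * K * \<omega> * r ^ n))"
      using M K \<omega> r by (simp add: ennreal_mult)
    also have "M * t powr p * (2 * K * \<omega> * r ^ n) = 1"
      using K \<omega> M t by (simp add: rn N_def)
    finally have 1: "V_seminorm s A ?u \<le> 1" by (intro V_seminorm_le_1) simp
    then have V: "?u \<in> V_space s A"
      by (auto simp: V_space_def tent_borel_measurable intro: le_less_trans)
    have "emeasure lebesgue (ball (0 :: real ^ 'n) r) = ennreal (\<omega> * r ^ n)"
      using r by (simp add: emeasure_ball \<omega>_def n_def)
    also have "\<omega> * r ^ n = Q / (M * t powr p)"
      using \<omega> by (simp add: rn N_def Q_def)
    finally have B: "emeasure lebesgue (ball (0 :: real ^ 'n) r) \<le> ennreal (Q / (M * t powr p))"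
      by simp
    have "r powr s = N powr (- s / n)" by (simp add: r_def powr_powr)
    also have "\<dots> = (2 * K * \<omega>) powr (- s / n) * M powr (- s / n) * (t powr p) powr (- s / n)"
      using K \<omega> M t by (simp add: N_def powr_mult)
    \<comment> \<open>This cancels the factor \<open>t\<close> in the height of the tent.\<close>
    also have "(t powr p) powr (- s / n) = 1 / t"
      using s n t by (simp add: powr_powr p_def powr_minus_divide)
    finally have "t * r powr s / (8 * 4 ^ n) = \<kappa> * M powr (- s / n)"
      using t by (simp add: \<kappa>_def)
    then have osc: "ennreal (\<kappa> * M powr (- s / n)) \<le> mean_osc (ball 0 r) ?u"
      using mean_osc_tent_ge[OF r, of t s, where 'n='n] t by (simp add: n_def)
    show "\<exists>u \<in> V_space s A :: (real ^ 'n \<Rightarrow> real) set. V_seminorm s A u \<le> 1 \<and>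
         (\<exists>B\<in>balls. emeasure lebesgue B \<le> ennreal (Q / (M * t powr (real CARD('n) / s))) \<and>
            ennreal (\<kappa> * M powr (- s / real CARD('n))) \<le> mean_osc B u)"
      using V 1 B osc r
      by (intro bexI[of _ ?u] conjI bexI[of _ "ball 0 r"]) (auto simp: p_def n_def balls_def)
  qed
qed

section \<open>The two equivalences\<close>

lemma ennreal_le_ratio_iff:
  assumes "0 \<le> c" "0 < d"
  shows "ennreal c \<le> x / ennreal d \<longleftrightarrow> ennreal (c * d) \<le> x"
proof (cases x)
  case (real q)
  then show ?thesis
    using assms by (simp add: divide_ennreal pos_le_divide_eq)
next
  case top
  then show ?thesis by (simp add: ennreal_top_divide)
qed

text \<open>With \<open>T = 0\<close> the only term depending on the radius disappears, so one
  constant \<open>C\<close> serves all balls. It is applied to \<open>u / k\<close> for each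
  admissible \<open>k\<close>, since the infimum in the seminorm need not be attained.\<close>

lemma BMO_embedding_if_power_bound:
  fixes s c :: real
  assumes s: "0 < s" "s < 1" and A: "young_function A" and c: "0 < c"
    and low: "\<And>t. 0 < t \<Longrightarrow> ennreal (c * t powr (real CARD('n) / s)) \<le> A t"
  shows "continuous_embedding (V_space s A :: (real ^ 'n::finite \<Rightarrow> real) set) (V_seminorm s A)
    BMO BMO_seminorm"
proof -
  define C where "C = 1 + 4 ^ CARD('n) / (unit_ball_vol (real CARD('n)) ^ 2 * c)"
  have C: "C > 0" using c by (auto simp: C_def intro: add_pos_nonneg)
  have int: "set_integrable lebesgue (ball z r) v"
    and osc: "mean_osc (ball z r) v \<le> ennreal C"
    if "v \<in> borel_measurable lebesgue" "J_fun s A v \<le> 1" "0 < r"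
    for v :: "real ^ 'n \<Rightarrow> real" and z r
    using set_integrable_ball_if_J_le_1[OF s A that(1,2) order_refl c low that(3) zero_less_one]
      mean_osc_ball_if_J_le_1[OF s A that(1,2) order_refl c low that(3) zero_less_one]
    by (auto simp: C_def)
  have L1: "u \<in> L1_loc" and BMO: "BMO_seminorm u \<le> ennreal C * V_seminorm s A u"
    if u: "u \<in> V_space s A" for u :: "real ^ 'n \<Rightarrow> real"
  proof -
    have um: "u \<in> borel_measurable lebesgue" and "V_seminorm s A u < \<infinity>"
      using u by (auto simp: V_space_def)
    then obtain l where l: "l > 0" "J_fun s A (\<lambda>x. u x / l) \<le> 1"
      by (auto simp: V_seminorm_def INF_less_iff)
    show "u \<in> L1_loc"
      unfolding L1_loc_def
    proof safe
      fix K :: "(real ^ 'n) set" assume K: "compact K"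
      then obtain R where R: "R > 0" "K \<subseteq> ball 0 R"
        using bounded_subset_ballD[OF compact_imp_bounded, of K 0] by auto
      have "set_integrable lebesgue (ball 0 R) (\<lambda>x. l * (u x / l))"
        using int[of "\<lambda>x. u x / l" R 0] um l R by (intro set_integrable_mult_right) auto
      then have "set_integrable lebesgue (ball 0 R) u" using l by simp
      then show "set_integrable lebesgue K u"
        by (rule set_integrable_subset) (use K R in \<open>auto intro: lmeasurable_compact fmeasurableD\<close>)
    qed
    \<comment> \<open>Dividing by \<open>C\<close> yields a lower bound for every admissible
      \<open>k\<close>, which passes to the infimum.\<close>
    have "BMO_seminorm u / ennreal C \<le> ennreal k"
      if k: "k > 0" "J_fun s A (\<lambda>x. u x / k) \<le> 1" for k
    proof -
      have "BMO_seminorm u \<le> ennreal k * ennreal C"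
        unfolding BMO_seminorm_def
      proof (rule SUP_least)
        fix B :: "(real ^ 'n) set" assume "B \<in> balls"
        then obtain z r where B: "B = ball z r" "r > 0" by (auto simp: balls_def)
        have "mean_osc B u = ennreal k * mean_osc B (\<lambda>x. u x / k)"
          using mean_osc_cmult[of "\<lambda>x. u x / k" k B] um k B by simp
        also have "\<dots> \<le> ennreal k * ennreal C"
          using osc um k B by (intro mult_left_mono) auto
        finally show "mean_osc B u \<le> ennreal k * ennreal C" .
      qed
      then have "BMO_seminorm u / ennreal C \<le> ennreal k * ennreal C / ennreal C"
        by (rule divide_right_mono_ennreal)
      then show ?thesis using C by (simp add: mult_divide_eq_ennreal)
    qed
    then have "BMO_seminorm u / ennreal C \<le> V_seminorm s A u"
      unfolding V_seminorm_def by (intro INF_greatest) auto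
    then have "ennreal C * (BMO_seminorm u / ennreal C) \<le> ennreal C * V_seminorm s A u"
      by (intro mult_left_mono) auto
    then show "BMO_seminorm u \<le> ennreal C * V_seminorm s A u"
      using C by (simp add: ennreal_times_divide mult_divide_eq_ennreal mult.commute)
  qed
  show ?thesis
    unfolding continuous_embedding_def
  proof (intro conjI exI[of _ C] ballI BMO subsetI)
    fix u :: "real ^ 'n \<Rightarrow> real" assume u: "u \<in> V_space s A"
    then have "V_seminorm s A u < \<infinity>" by (simp add: V_space_def)
    then have "ennreal C * V_seminorm s A u < \<infinity>" by (simp add: ennreal_mult_less_top)
    then show "u \<in> BMO" using L1[OF u] BMO[OF u] by (auto simp: BMO_def)
  qed (use C in auto)
qed

text \<open>The choices are made in the order \<open>e\<close>, \<open>M\<close>, \<open>T\<close>,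
  \<open>\<rho>0\<close>, none of which depends on \<open>u\<close>; this gives the
  uniformity.\<close>

lemma small_osc_bound_if_superpower:
  fixes s \<epsilon> :: real
  assumes s: "0 < s" "s < 1" and A: "young_function A" and \<epsilon>: "0 < \<epsilon>"
    and lim: "((\<lambda>t. A t / ennreal (t powr (real CARD('n) / s))) \<longlongrightarrow> \<infinity>) at_top"
  obtains r0 where "r0 > 0"
    "\<And>r u. r < r0 \<Longrightarrow> u \<in> V_space s A \<Longrightarrow> V_seminorm s A u \<le> 1 \<Longrightarrow>
       small_osc r (u :: real ^ 'n::finite \<Rightarrow> real) \<le> ennreal \<epsilon>"
proof -
  define n where "n = CARD('n)"
  define p where "p = real n / s"
  define \<omega> where "\<omega> = unit_ball_vol (real n)"
  have \<omega>: "\<omega> > 0" by (simp add: \<omega>_def)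
  \<comment> \<open>Three terms of size at most \<open>e\<close>, doubled by the normalization
    \<open>k < 2\<close>.\<close>
  define e where "e = \<epsilon> / 6"
  have e: "e > 0" using \<epsilon> by (simp add: e_def)
  \<comment> \<open>Solves the equation that the modular term equals \<open>e\<close>.\<close>
  define M where "M = e powr (- p) * 4 ^ n / \<omega> ^ 2"
  have M: "M > 0" using e \<omega> by (simp add: M_def)
  have Me: "e powr (1 - p) * 4 ^ n / (\<omega> ^ 2 * M) = e"
    using e \<omega> by (simp add: M_def powr_diff powr_minus field_simps)
  have "\<forall>\<^sub>F t in at_top. ennreal M < A t / ennreal (t powr p)"
    using lim M by (auto simp: tendsto_top_iff_ennreal p_def n_def)
  then obtain T' where T': "\<And>t. T' \<le> t \<Longrightarrow> ennreal M < A t / ennreal (t powr p)"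
    by (auto simp: eventually_at_top_linorder)
  define T where "T = max 1 T'"
  have T: "T \<ge> 1" by (simp add: T_def)
  have low: "ennreal (M * t powr p) \<le> A t" if "T \<le> t" "0 < t" for t
    using T'[of t] that M by (subst ennreal_le_ratio_iff[symmetric]) (auto simp: T_def)
  \<comment> \<open>Solves \<open>T * (2 * \<rho>0) powr s = e\<close>; the maximum with 1 in
    \<open>T\<close> permits the division.\<close>
  define \<rho>0 where "\<rho>0 = (e / T) powr (1 / s) / 2"
  have \<rho>0: "\<rho>0 > 0" using e T by (simp add: \<rho>0_def)
  have T\<rho>0: "T * (2 * \<rho>0) powr s = e"
    using e T s by (simp add: \<rho>0_def powr_powr)
  show ?thesis
  \<comment> \<open>The threshold is the measure of a ball of radius \<open>\<rho>0\<close>, as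
    \<open>small_osc\<close> restricts measures and not radii.\<close>
  proof (rule that[of "\<omega> * \<rho>0 ^ n"])
    show "0 < \<omega> * \<rho>0 ^ n" using \<omega> \<rho>0 by simp
  next
    fix r and u :: "real ^ 'n \<Rightarrow> real"
    assume r: "r < \<omega> * \<rho>0 ^ n" and u: "u \<in> V_space s A" and u1: "V_seminorm s A u \<le> 1"
    have um: "u \<in> borel_measurable lebesgue" using u by (simp add: V_space_def)
    \<comment> \<open>A strict inequality is needed to extract an admissible
      \<open>k\<close>.\<close>
    have "V_seminorm s A u < ennreal 2"
      using u1 by (rule le_less_trans) (simp flip: ennreal_numeral)
    then obtain k where k: "k > 0" "J_fun s A (\<lambda>x. u x / k) \<le> 1" "k < 2"
      by (auto simp: V_seminorm_def INF_less_iff ennreal_less_iff)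
    show "small_osc r u \<le> ennreal \<epsilon>"
      unfolding small_osc_def
    proof (rule SUP_least)
      fix B :: "(real ^ 'n) set" assume "B \<in> {B \<in> balls. emeasure lebesgue B \<le> ennreal r}"
      then obtain z \<rho> where B: "B = ball z \<rho>" "\<rho> > 0" "emeasure lebesgue (ball z \<rho>) \<le> ennreal r"
        by (auto simp: balls_def)
      \<comment> \<open>Positivity excludes \<open>r \<le> 0\<close>, where \<open>ennreal r\<close>
        collapses to 0.\<close>
      have "\<omega> * \<rho> ^ n > 0" using \<omega> B by simp
      moreover have "ennreal (\<omega> * \<rho> ^ n) \<le> ennreal r"
        using B by (simp add: emeasure_ball \<omega>_def n_def)
      ultimately have "\<omega> * \<rho> ^ n \<le> r"
        by (simp add: ennreal_le_iff2)
      then have "\<rho> ^ n < \<rho>0 ^ n" using r \<omega>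
        by (smt (verit, best) mult_left_mono)
      then have "\<rho> < \<rho>0" using \<rho>0 by (intro power_less_imp_less_base[of \<rho> n]) auto
      then have "T * (2 * \<rho>) powr s \<le> T * (2 * \<rho>0) powr s"
        using T s B by (intro mult_left_mono powr_mono2) auto
      then have le: "T * (2 * \<rho>) powr s + e + e powr (1 - p) * 4 ^ n / (\<omega> ^ 2 * M) \<le> 3 * e"
        using T\<rho>0 Me by simp
      have "mean_osc B (\<lambda>x. u x / k)
          \<le> ennreal (T * (2 * \<rho>) powr s + e + e powr (1 - p) * 4 ^ n / (\<omega> ^ 2 * M))"
        using mean_osc_ball_if_J_le_1[OF s A _ k(2) _ M _ B(2) e, of T z] um T low
        by (simp add: B(1) n_def p_def \<omega>_def)
      also have "\<dots> \<le> ennreal (3 * e)" using le by (rule ennreal_leI)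
      finally have v: "mean_osc B (\<lambda>x. u x / k) \<le> ennreal (3 * e)" .
      have "mean_osc B u = ennreal k * mean_osc B (\<lambda>x. u x / k)"
        using mean_osc_cmult[of "\<lambda>x. u x / k" k B] um k B by simp
      also have "\<dots> \<le> ennreal 2 * ennreal (3 * e)"
        using k v by (intro mult_mono ennreal_leI) auto
      also have "\<dots> = ennreal \<epsilon>"
        using e by (simp only: ennreal_mult[symmetric]) (simp add: e_def)
      finally show "mean_osc B u \<le> ennreal \<epsilon>" .
    qed
  qed
qed

text \<open>A \<open>t\<close> violating the bound would give a function in the unit ball of the
  seminorm that oscillates by \<open>2 * C\<close>, twice what the embedding allows. Since
  \<open>M\<close> is independent of \<open>t\<close>, it serves as \<open>c\<close>.\<close>

lemma power_bound_if_BMO_embedding: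
  fixes s :: real
  assumes s: "0 < s" "s < 1" and A: "young_function A"
    and emb: "continuous_embedding (V_space s A :: (real ^ 'n::finite \<Rightarrow> real) set) (V_seminorm s A)
      BMO BMO_seminorm"
  obtains c :: real where "c > 0" "\<And>t. t > 0 \<Longrightarrow> ennreal (c * t powr (real CARD('n) / s)) \<le> A t"
proof -
  obtain C :: real where C: "C > 0"
    "\<And>u :: real ^ 'n \<Rightarrow> real. u \<in> V_space s A \<Longrightarrow> BMO_seminorm u \<le> ennreal C * V_seminorm s A u"
    using emb unfolding continuous_embedding_def by blast
  obtain Q \<kappa> :: real where Q: "Q > 0" "\<kappa> > 0"
    "\<And>M t. M > 0 \<Longrightarrow> t > 0 \<Longrightarrow> A t \<le> ennreal (M * t powr (real CARD('n) / s)) \<Longrightarrow>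
       \<exists>u \<in> V_space s A :: (real ^ 'n \<Rightarrow> real) set. V_seminorm s A u \<le> 1 \<and>
         (\<exists>B\<in>balls. emeasure lebesgue B \<le> ennreal (Q / (M * t powr (real CARD('n) / s))) \<and>
            ennreal (\<kappa> * M powr (- s / real CARD('n))) \<le> mean_osc B u)"
    using large_oscillation_functions[OF s A, where 'n='n] by blast
  \<comment> \<open>Obtained by solving \<open>\<kappa> * M powr (- s / n) = 2 * C\<close> for
    \<open>M\<close>.\<close>
  define M where "M = (\<kappa> / (2 * C)) powr (real CARD('n) / s)"
  have M: "M > 0" using C Q by (simp add: M_def)
  have "\<kappa> * M powr (- s / real CARD('n)) = \<kappa> * (\<kappa> / (2 * C)) powr (- 1)"
    using s by (simp add: M_def powr_powr)
  also have "\<dots> = 2 * C"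
    using C Q by (simp add: powr_minus_divide)
  finally have MC: "\<kappa> * M powr (- s / real CARD('n)) = 2 * C" .
  show ?thesis
  proof (rule that[OF M], rule ccontr)
    fix t :: real assume t: "t > 0" and "\<not> ennreal (M * t powr (real CARD('n) / s)) \<le> A t"
    then obtain u :: "real ^ 'n \<Rightarrow> real" and B where u: "u \<in> V_space s A" "V_seminorm s A u \<le> 1"
      "B \<in> balls" "ennreal (2 * C) \<le> mean_osc B u"
      using Q(3)[OF M t] unfolding MC by fastforce
    have "ennreal (2 * C) \<le> BMO_seminorm u"
      unfolding BMO_seminorm_def using u(3,4) by (rule SUP_upper2)
    also have "\<dots> \<le> ennreal C * V_seminorm s A u" using C u by simp
    also have "\<dots> \<le> ennreal C * 1" using u(2) by (rule mult_left_mono) simp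
    finally show False using C by (simp add: ennreal_le_iff)
  qed
qed

text \<open>If the ratio stayed below \<open>M\<close> at arbitrarily large \<open>t\<close>,
  oscillations of fixed size \<open>\<epsilon>\<close> would occur on balls of measure tending to
  0.\<close>

lemma superpower_if_uniform_VMO_embedding:
  fixes s :: real
  assumes s: "0 < s" "s < 1" and A: "young_function A"
    and emb: "uniform_VMO_embedding (V_space s A :: (real ^ 'n::finite \<Rightarrow> real) set) (V_seminorm s A)"
  shows "((\<lambda>t. A t / ennreal (t powr (real CARD('n) / s))) \<longlongrightarrow> \<infinity>) at_top"
  unfolding infinity_ennreal_def tendsto_top_iff_ennreal
proof (intro allI impI)
  fix l :: real assume l: "l \<ge> 0"
  define p where "p = real CARD('n) / s"
  have p: "p > 0" using s by (simp add: p_def)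
  obtain Q \<kappa> :: real where Q: "Q > 0" "\<kappa> > 0"
    "\<And>M t. M > 0 \<Longrightarrow> t > 0 \<Longrightarrow> A t \<le> ennreal (M * t powr p) \<Longrightarrow>
       \<exists>u \<in> V_space s A :: (real ^ 'n \<Rightarrow> real) set. V_seminorm s A u \<le> 1 \<and>
         (\<exists>B\<in>balls. emeasure lebesgue B \<le> ennreal (Q / (M * t powr p)) \<and>
            ennreal (\<kappa> * M powr (- s / real CARD('n))) \<le> mean_osc B u)"
    unfolding p_def using large_oscillation_functions[OF s A, where 'n='n] by blast
  \<comment> \<open>Strictly above \<open>l\<close>, because the limit asks for a strict
    inequality.\<close>
  define M where "M = l + 1"
  have M: "M > 0" using l by (simp add: M_def)
  define \<epsilon> where "\<epsilon> = \<kappa> * M powr (- s / real CARD('n))"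
  have \<epsilon>: "\<epsilon> > 0" using Q M by (simp add: \<epsilon>_def)
  have "\<forall>\<^sub>F r in at_right 0.
      (SUP u\<in>{u \<in> V_space s A :: (real ^ 'n \<Rightarrow> real) set. V_seminorm s A u \<le> 1}. small_osc r u) < ennreal \<epsilon>"
    using emb \<epsilon> unfolding uniform_VMO_embedding_def by (auto intro: order_tendstoD)
  then obtain \<delta> where \<delta>: "\<delta> > 0" "\<And>r. 0 < r \<Longrightarrow> r < \<delta> \<Longrightarrow>
      (SUP u\<in>{u \<in> V_space s A :: (real ^ 'n \<Rightarrow> real) set. V_seminorm s A u \<le> 1}. small_osc r u) < ennreal \<epsilon>"
    by (auto simp: eventually_at_right_field)
  define r where "r = \<delta> / 2"
  have r: "0 < r" "r < \<delta>" using \<delta> by (auto simp: r_def)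
  \<comment> \<open>Once t^p reaches \<open>x\<close>, the ball has measure at most
    \<open>r\<close>.\<close>
  define x where "x = Q / (M * r)"
  have x: "x > 0" using Q M r by (simp add: x_def)
  have "\<forall>\<^sub>F t in at_top. x \<le> t powr p"
    using eventually_ge_at_top[of "x powr (1 / p)"]
  proof eventually_elim
    case (elim t)
    have "x = (x powr (1 / p)) powr p" using x p by (simp add: powr_powr)
    also have "\<dots> \<le> t powr p" using elim p by (intro powr_mono2) auto
    finally show ?case .
  qed
  then show "\<forall>\<^sub>F t in at_top. ennreal l < A t / ennreal (t powr (real CARD('n) / s))"
    using eventually_gt_at_top[of 0] unfolding p_def[symmetric]
  proof eventually_elim
    case (elim t)
    have "ennreal (M * t powr p) \<le> A t"
    proof (rule ccontr)
      assume "\<not> ennreal (M * t powr p) \<le> A t"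
      then obtain u :: "real ^ 'n \<Rightarrow> real" and B where u: "u \<in> V_space s A" "V_seminorm s A u \<le> 1"
        and B: "B \<in> balls" "emeasure lebesgue B \<le> ennreal (Q / (M * t powr p))" "ennreal \<epsilon> \<le> mean_osc B u"
        using Q(3)[OF M elim(2)] unfolding \<epsilon>_def by fastforce
      have "Q / (M * t powr p) \<le> r"
        using elim M r by (simp add: x_def field_simps)
      then have "emeasure lebesgue B \<le> ennreal r"
        using B(2) by (meson ennreal_leI order_trans)
      then have "ennreal \<epsilon> \<le> small_osc r u"
        unfolding small_osc_def using B by (intro SUP_upper2[of B]) auto
      also have "\<dots> \<le> (SUP u\<in>{u \<in> V_space s A :: (real ^ 'n \<Rightarrow> real) set. V_seminorm s A u \<le> 1}. small_osc r u)"
        using u by (intro SUP_upper) auto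
      also have "\<dots> < ennreal \<epsilon>" using \<delta>(2)[OF r] .
      finally show False by simp
    qed
    then have "ennreal M \<le> A t / ennreal (t powr p)"
      using M elim by (subst ennreal_le_ratio_iff) auto
    moreover have "ennreal l < ennreal M" using l by (simp add: M_def ennreal_less_iff)
    ultimately show ?case by (rule less_le_trans[rotated])
  qed
qed

lemma uniform_VMO_embedding_if_superpower:
  fixes s :: real
  assumes s: "0 < s" "s < 1" and A: "young_function A"
    and emb: "continuous_embedding (V_space s A :: (real ^ 'n::finite \<Rightarrow> real) set) (V_seminorm s A)
      BMO BMO_seminorm"
    and lim: "((\<lambda>t. A t / ennreal (t powr (real CARD('n) / s))) \<longlongrightarrow> \<infinity>) at_top"
  shows "uniform_VMO_embedding (V_space s A :: (real ^ 'n \<Rightarrow> real) set) (V_seminorm s A)"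
  unfolding uniform_VMO_embedding_def
proof (intro conjI emb order_tendstoI)
  fix a :: ennreal assume "0 < a"
  \<comment> \<open>The supremum preserves only a weak bound, so room is left below
    \<open>a\<close>; being below \<open>a\<close>, \<open>b\<close> is also finite.\<close>
  then obtain b where b: "0 < b" "b < a" using dense by blast
  then obtain \<epsilon> where \<epsilon>: "b = ennreal \<epsilon>" "0 < \<epsilon>"
    by (cases b) auto
  obtain r0 where r0: "r0 > 0" "\<And>r u. r < r0 \<Longrightarrow> u \<in> V_space s A \<Longrightarrow> V_seminorm s A u \<le> 1 \<Longrightarrow>
       small_osc r (u :: real ^ 'n \<Rightarrow> real) \<le> ennreal \<epsilon>"
    using small_osc_bound_if_superpower[OF s A \<epsilon>(2) lim] by blast
  have "\<forall>\<^sub>F r in at_right 0. r < r0"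
    using r0(1) by (auto simp: eventually_at_right_field)
  then show "\<forall>\<^sub>F r in at_right 0.
      (SUP u\<in>{u \<in> V_space s A :: (real ^ 'n \<Rightarrow> real) set. V_seminorm s A u \<le> 1}. small_osc r u) < a"
  proof eventually_elim
    case (elim r)
    have "(SUP u\<in>{u \<in> V_space s A :: (real ^ 'n \<Rightarrow> real) set. V_seminorm s A u \<le> 1}. small_osc r u)
        \<le> ennreal \<epsilon>"
      using r0(2)[OF elim] by (intro SUP_least) auto
    then show ?case using b \<epsilon> by (auto intro: le_less_trans)
  qed
qed simp

theorem corollary3p2:
  fixes s :: real and A :: "real \<Rightarrow> ennreal"
  assumes "0 < s" and "s < 1" and "young_function A"
  shows "(continuous_embedding (V_space s A :: (real ^ 'n::finite \<Rightarrow> real) set) (V_seminorm s A)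
            BMO BMO_seminorm \<longleftrightarrow>
          (\<exists>c::real. c > 0 \<and>
             (\<forall>t>0. A t / ennreal (t powr (real CARD('n) / s)) \<ge> ennreal c))) \<and>
         (uniform_VMO_embedding (V_space s A :: (real ^ 'n \<Rightarrow> real) set) (V_seminorm s A) \<longleftrightarrow>
          (\<exists>c::real. c > 0 \<and>
             (\<forall>t>0. A t / ennreal (t powr (real CARD('n) / s)) \<ge> ennreal c)) \<and>
          ((\<lambda>t. A t / ennreal (t powr (real CARD('n) / s))) \<longlongrightarrow> \<infinity>) at_top)"
proof -
  \<comment> \<open>The product form avoids division in \<open>ennreal\<close>; it is equivalent
    because the power is positive for \<open>t > 0\<close>.\<close>
  have ratio: "(\<exists>c::real. c > 0 \<and> (\<forall>t>0. A t / ennreal (t powr (real CARD('n) / s)) \<ge> ennreal c))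
      \<longleftrightarrow> (\<exists>c::real. c > 0 \<and> (\<forall>t>0. ennreal (c * t powr (real CARD('n) / s)) \<le> A t))"
    by (intro ex_cong1 conj_cong refl all_cong) (simp add: ennreal_le_ratio_iff)
  have i: "continuous_embedding (V_space s A :: (real ^ 'n \<Rightarrow> real) set) (V_seminorm s A) BMO BMO_seminorm
      \<longleftrightarrow> (\<exists>c::real. c > 0 \<and> (\<forall>t>0. ennreal (c * t powr (real CARD('n) / s)) \<le> A t))"
    using power_bound_if_BMO_embedding[OF assms, where 'n='n]
      BMO_embedding_if_power_bound[OF assms, where 'n='n] by metis
  \<comment> \<open>The BMO embedding is one half of the uniform one, so (i) turns it into the power
    bound and only the limit remains.\<close>
  have "uniform_VMO_embedding (V_space s A :: (real ^ 'n \<Rightarrow> real) set) (V_seminorm s A) \<longleftrightarrow>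
      continuous_embedding (V_space s A :: (real ^ 'n \<Rightarrow> real) set) (V_seminorm s A) BMO BMO_seminorm \<and>
      ((\<lambda>t. A t / ennreal (t powr (real CARD('n) / s))) \<longlongrightarrow> \<infinity>) at_top"
    using superpower_if_uniform_VMO_embedding[OF assms, where 'n='n]
      uniform_VMO_embedding_if_superpower[OF assms, where 'n='n]
    unfolding uniform_VMO_embedding_def by blast
  then show ?thesis unfolding ratio i[symmetric] by blast
qed

end
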